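(* Let $n\ge 1$ and let $P(n)$ denote the number of convex pentagons in an $n$-triangular net. Then \[ P(n)=\begin{cases} \frac{1}{10}\left(12k^5+25k^4+5k^3-10k^2-2k\right), & n=2k+1\ (k=0,1,2,\dots),\\[2pt] \frac{1}{10}\left(12k^5-5k^4-15k^3+5k^2+3k\right), & n=2k\ (k=1,2,\dots).\end{cases} \]
   Context: An $n$-triangular net ($n\ge 1$) is obtained from a triangle by dividing each of its three edges into $n$ equal parts and then, for each pair of edges, drawing the $n-1$ segments joining corresponding dividing points on those two edges parallel to the third edge. (For $n=1$ it is just the triangle.) The net thus consists of the three edges of the triangle together with these segments; all line segments of the net lie on lines parallel to one of the three sides. A convex pentagon in the net is a convex polygon with exactly five vertices (each interior angle strictly less than $\pi$) whose sides all lie on segments of the net (so its vertices are intersection points of the net). The count depends only on $n$, not on the shape or size of the triangle. *)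

theory Defs
  imports "HOL-Analysis.Analysis"
begin

definition div_point :: "nat \<Rightarrow> real^2 \<Rightarrow> real^2 \<Rightarrow> nat \<Rightarrow> real^2" where
  "div_point n X Y i = X + (real i / real n) *\<^sub>R (Y - X)"

text \<open>For the pair of edges \<open>XY\<close>, \<open>XZ\<close> meeting at \<open>X\<close>, the corresponding dividing
  points are those at the same fraction \<open>i/n\<close> from \<open>X\<close>, so that the joining segments are
  parallel to \<open>YZ\<close>.\<close>

definition inner_segments :: "nat \<Rightarrow> real^2 \<Rightarrow> real^2 \<Rightarrow> real^2 \<Rightarrow> (real^2) set set" where
  "inner_segments n X Y Z =
     {closed_segment (div_point n X Y i) (div_point n X Z i) | i. 1 \<le> i \<and> i < n}"

definition triangular_net :: "nat \<Rightarrow> real^2 \<Rightarrow> real^2 \<Rightarrow> real^2 \<Rightarrow> (real^2) set set" where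
  "triangular_net n A B C =
     {closed_segment A B, closed_segment B C, closed_segment C A}
     \<union> inner_segments n A B C \<union> inner_segments n B C A \<union> inner_segments n C A B"

text \<open>A polygon is identified with the closed region it bounds. Its vertices are the extreme
  points, so every interior angle is automatically less than \<open>\<pi>\<close>.\<close>

definition convex_pentagon :: "(real^2) set \<Rightarrow> bool" where
  "convex_pentagon S \<longleftrightarrow>
     polytope S \<and> aff_dim S = 2 \<and> card {v. v extreme_point_of S} = 5"

definition net_pentagons :: "nat \<Rightarrow> real^2 \<Rightarrow> real^2 \<Rightarrow> real^2 \<Rightarrow> (real^2) set set" where
  "net_pentagons n A B C =
     {S. convex_pentagon S \<and>
         (\<forall>e. e edge_of S \<longrightarrow> (\<exists>s \<in> triangular_net n A B C. e \<subseteq> s))}"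

end

theory Submission
  imports Defs
begin

text \<open>
  In barycentric coordinates \<open>x + y + z = n\<close> the lines of the net are the integer level lines of
  \<open>x\<close>, \<open>y\<close> and \<open>z\<close>. A polygon whose edges have only these three directions is cut out by the
  extreme values of \<open>x\<close>, \<open>y\<close>, \<open>z\<close> on it, so it is the smallest enclosing upright triangle
  \<open>x \<ge> a, y \<ge> b, z \<ge> c\<close> of size \<open>s = n - a - b - c\<close> with triangles of sizes \<open>p\<close>, \<open>q\<close>, \<open>r\<close> cut off at its
  corners. This is a hexagon with sides \<open>p\<close>, \<open>q\<close>, \<open>r\<close>, \<open>s - q - r\<close>, \<open>s - r - p\<close>, \<open>s - p - q\<close>, which is a
  pentagon iff exactly one of these numbers vanishes, and it belongs to the net iff all parameters are
  natural numbers. There are \<open>(n - s + 2) choose 2\<close> positions for each size \<open>s\<close>.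
\<close>

section \<open>Counting the parameters\<close>

text \<open>The side lengths \<open>p\<close>, \<open>q\<close>, \<open>r\<close>, \<open>s - q - r\<close>, \<open>s - r - p\<close>, \<open>s - p - q\<close> are nonnegative and exactly
  one of them is zero; inequalities implied by the others are left out.\<close>

definition one_side_zero :: "'a::linordered_semidom \<Rightarrow> 'a \<Rightarrow> 'a \<Rightarrow> 'a \<Rightarrow> bool" where
  "one_side_zero s p q r \<longleftrightarrow>
     (p = 0 \<and> 0 < q \<and> 0 < r \<and> q + r < s) \<or>
     (q = 0 \<and> 0 < r \<and> 0 < p \<and> r + p < s) \<or>
     (r = 0 \<and> 0 < p \<and> 0 < q \<and> p + q < s) \<or>
     (q + r = s \<and> 0 < p \<and> p < q \<and> p < r) \<or>
     (r + p = s \<and> 0 < q \<and> q < r \<and> q < p) \<or>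
     (p + q = s \<and> 0 < r \<and> r < p \<and> r < q)"

text \<open>Sizes of two cuts that leave a positive stretch of their common side, the third corner
  being uncut.\<close>

definition pairs :: "nat \<Rightarrow> (nat \<times> nat) set" where
  "pairs s = {(p, q). 0 < p \<and> 0 < q \<and> p + q < s}"

text \<open>For shapes in which two cuts, of sizes \<open>q\<close> and \<open>s - q\<close>, meet
  on a side: the third cut \<open>p\<close> must be smaller than both, and \<open>p < s - q\<close>
  reads \<open>p + q < s\<close>.\<close>

definition ordered_pairs :: "nat \<Rightarrow> (nat \<times> nat) set" where
  "ordered_pairs s = {(p, q). 0 < p \<and> p < q \<and> p + q < s}"

lemma finite_pairs [simp]: "finite (pairs s)"
  by (rule finite_subset [of _ "{..s} \<times> {..s}"]) (auto simp: pairs_def)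

lemma finite_ordered_pairs [simp]: "finite (ordered_pairs s)"
  by (rule finite_subset [of _ "{..s} \<times> {..s}"]) (auto simp: ordered_pairs_def)

lemma card_pairs_Suc: "card (pairs (Suc s)) = card (pairs s) + (s - 1)"
proof -
  have "pairs (Suc s) = pairs s \<union> (\<lambda>p. (p, s - p)) ` {1..<s}"
    by (force simp: pairs_def image_iff)
  moreover have "pairs s \<inter> (\<lambda>p. (p, s - p)) ` {1..<s} = {}"
    by (auto simp: pairs_def)
  moreover have "card ((\<lambda>p. (p, s - p)) ` {1..<s}) = s - 1"
    by (simp add: card_image inj_on_def)
  ultimately show ?thesis
    by (simp add: card_Un_disjoint)
qed

text \<open>The pairs gained lie on the diagonal \<open>p + q = s\<close>, where
  \<open>p < s - p\<close> means \<open>p \<le> (s - 1) div 2\<close>.\<close>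

lemma card_ordered_pairs_Suc: "card (ordered_pairs (Suc s)) = card (ordered_pairs s) + (s - 1) div 2"
proof -
  have "ordered_pairs (Suc s) = ordered_pairs s \<union> (\<lambda>p. (p, s - p)) ` {1..(s - 1) div 2}"
    by (force simp: ordered_pairs_def image_iff)
  moreover have "ordered_pairs s \<inter> (\<lambda>p. (p, s - p)) ` {1..(s - 1) div 2} = {}"
    by (auto simp: ordered_pairs_def)
  moreover have "card ((\<lambda>p. (p, s - p)) ` {1..(s - 1) div 2}) = (s - 1) div 2"
    by (simp add: card_image inj_on_def)
  ultimately show ?thesis
    by (simp add: card_Un_disjoint)
qed

lemma card_pairs_0 [simp]: "card (pairs 0) = 0" "card (ordered_pairs 0) = 0"
  by (auto simp: pairs_def ordered_pairs_def)

text \<open>The increment \<open>(s - 1) div 2\<close> depends on the parity of \<open>s\<close>, so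
  the induction advances by two sizes; odd sizes need one further step. Truncated subtraction gives
  the right value 0 at \<open>k = 0\<close>.\<close>

lemma card_pairs: "card (pairs (2 * k)) = (2 * k - 1) * (k - 1)"
    "card (pairs (Suc (2 * k))) = k * (2 * k - 1)"
    "card (ordered_pairs (2 * k)) = (k - 1) ^ 2" 
    "card (ordered_pairs (Suc (2 * k))) = k * (k - 1)"
proof -
  have "card (pairs (2 * k)) = (2 * k - 1) * (k - 1) \<and> card (ordered_pairs (2 * k)) = (k - 1) ^ 2"
  proof (induction k)
    case (Suc k)
    then show ?case
      by (cases k) (auto simp: card_pairs_Suc card_ordered_pairs_Suc power2_eq_square algebra_simps)
  qed auto
  then show *: "card (pairs (2 * k)) = (2 * k - 1) * (k - 1)" "card (ordered_pairs (2 * k)) = (k - 1) ^ 2"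
    by auto
  show "card (pairs (Suc (2 * k))) = k * (2 * k - 1)"
    unfolding card_pairs_Suc * by (cases k) (simp_all add: algebra_simps)
  have "(2 * k - 1) div 2 = k - 1" by simp
  then show "card (ordered_pairs (Suc (2 * k))) = k * (k - 1)"
    unfolding card_ordered_pairs_Suc * by (cases k) (simp_all add: power2_eq_square algebra_simps)
qed

section \<open>Shapes inside an enclosing triangle of fixed size\<close>

definition shapes :: "nat \<Rightarrow> (nat \<times> nat \<times> nat) set" where
  "shapes s = {(p, q, r). one_side_zero s p q r}"

text \<open>One image per disjunct of \<open>one_side_zero\<close>: either a cut is absent and the
  other two are free, or two cuts meet, so that one of them is \<open>s - j\<close> and the smallest
  cut is \<open>i\<close>.\<close>

lemma shapes_eq:
  "shapes s = (\<lambda>(i, j). (0, i, j)) ` pairs s \<union> (\<lambda>(i, j). (i, 0, j)) ` pairs s \<union>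
     (\<lambda>(i, j). (i, j, 0)) ` pairs s \<union> (\<lambda>(i, j). (i, j, s - j)) ` ordered_pairs s \<union>
     (\<lambda>(i, j). (j, i, s - j)) ` ordered_pairs s \<union> (\<lambda>(i, j). (j, s - j, i)) ` ordered_pairs s" (is "_ = ?R")
proof -
  have img: "(p, q, r) \<in> (\<lambda>(i, j). (0, i, j)) ` X \<longleftrightarrow> p = 0 \<and> (q, r) \<in> X"
    "(p, q, r) \<in> (\<lambda>(i, j). (i, 0, j)) ` X \<longleftrightarrow> q = 0 \<and> (p, r) \<in> X"
    "(p, q, r) \<in> (\<lambda>(i, j). (i, j, 0)) ` X \<longleftrightarrow> r = 0 \<and> (p, q) \<in> X"
    "(p, q, r) \<in> (\<lambda>(i, j). (i, j, s - j)) ` X \<longleftrightarrow> r = s - q \<and> (p, q) \<in> X"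
    "(p, q, r) \<in> (\<lambda>(i, j). (j, i, s - j)) ` X \<longleftrightarrow> r = s - p \<and> (q, p) \<in> X"
    "(p, q, r) \<in> (\<lambda>(i, j). (j, s - j, i)) ` X \<longleftrightarrow> q = s - p \<and> (r, p) \<in> X"
    for p q r :: nat and X by auto
  have ord: "(j + k = s \<and> 0 < i \<and> i < j \<and> i < k) \<longleftrightarrow> (k = s - j \<and> 0 < i \<and> i < j \<and> i + j < s)"
    "(j + k = s \<and> 0 < i \<and> i < k \<and> i < j) \<longleftrightarrow> (k = s - j \<and> 0 < i \<and> i < j \<and> i + j < s)"
    for i j k :: nat by auto
  have "(p, q, r) \<in> shapes s \<longleftrightarrow> (p, q, r) \<in> ?R" for p q r
    unfolding Un_iff img shapes_def pairs_def ordered_pairs_def one_side_zero_def mem_Collect_eq prod.case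
      ord(1) [of q r p] ord(2) [of p r q] ord(1) [of p q r] add.commute [of r p]
    by blast
  then show ?thesis by auto
qed

lemma finite_shapes [simp]: "finite (shapes s)"
  by (simp add: shapes_eq)

text \<open>The six images are disjoint because only one side of the hexagon may vanish.\<close>

lemma card_shapes: "card (shapes s) = 3 * (card (pairs s) + card (ordered_pairs s))"
proof -
  have inj: "inj_on (\<lambda>(i, j). (0::nat, i, j)) (pairs s)" "inj_on (\<lambda>(i, j). (i, 0::nat, j)) (pairs s)"
    "inj_on (\<lambda>(i, j). (i, j, 0::nat)) (pairs s)"
    "inj_on (\<lambda>(i, j). (i, j, s - j)) (ordered_pairs s)"
    "inj_on (\<lambda>(i, j). (j, i, s - j)) (ordered_pairs s)"
    "inj_on (\<lambda>(i, j). (j, s - j, i)) (ordered_pairs s)"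
    by (auto simp: inj_on_def)
  show ?thesis
    unfolding shapes_eq
    apply (subst card_Un_disjoint, simp, simp, force simp: pairs_def ordered_pairs_def)+
    using inj by (simp add: card_image)
qed

text \<open>Splitting on \<open>a\<close>: a positive \<open>a\<close> is lowered by one, and for
  \<open>a = 0\<close> the choice of \<open>b\<close> is free. This is Pascal's rule.\<close>

lemma card_sum_eq_3: "card {(a::nat, b::nat, c::nat). a + b + c = m} = (m + 2) choose 2"
proof (induction m)
  case 0
  have "{(a::nat, b::nat, c::nat). a + b + c = 0} = {(0, 0, 0)}" by auto
  then show ?case by (simp add: numeral_2_eq_2)
next
  case (Suc m)
  have eq: "{(a::nat, b::nat, c::nat). a + b + c = Suc m} =
    (\<lambda>(a, b, c). (Suc a, b, c)) ` {(a, b, c). a + b + c = m} \<union> (\<lambda>b. (0, b, Suc m - b)) ` {..Suc m}"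
    (is "_ = ?L \<union> ?R")
  proof (rule set_eqI)
    fix t :: "nat \<times> nat \<times> nat"
    obtain a b c where t: "t = (a, b, c)" by (cases t)
    show "t \<in> {(a, b, c). a + b + c = Suc m} \<longleftrightarrow> t \<in> ?L \<union> ?R"
      by (cases a) (auto simp: t image_iff)
  qed
  have fin: "finite {(a::nat, b::nat, c::nat). a + b + c = m}"
    by (rule finite_subset [of _ "{..m} \<times> {..m} \<times> {..m}"]) auto
  have "card ?L = (m + 2) choose 2"
    using Suc by (subst card_image) (auto simp: inj_on_def)
  moreover have "card ?R = m + 2"
    by (subst card_image) (auto simp: inj_on_def)
  moreover have "?L \<inter> ?R = {}" by auto
  ultimately show ?case
    unfolding eq using fin by (simp add: card_Un_disjoint numeral_2_eq_2)
qed

section \<open>Summation over the size of the enclosing triangle\<close>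

definition placements :: "nat \<Rightarrow> (nat \<times> nat \<times> nat \<times> nat \<times> nat \<times> nat) set" where
  "placements n = {(a, b, c, p, q, r). a + b + c \<le> n \<and> one_side_zero (n - (a + b + c)) p q r}"

lemma card_placements_sum:
  "finite (placements n) \<and>
   card (placements n) = (\<Sum>s\<le>n. ((n - s + 2) choose 2) * card (shapes s))"
proof -
  let ?T = "\<lambda>m. {(a::nat, b::nat, c::nat). a + b + c = m}"
  let ?X = "SIGMA s:{..n}. ?T (n - s) \<times> shapes s"
  let ?f = "\<lambda>(s::nat, (a::nat, b::nat, c::nat), (p::nat, q::nat, r::nat)). (a, b, c, p, q, r)"
  have fin: "finite (?T m)" for m
    by (rule finite_subset [of _ "{..m} \<times> {..m} \<times> {..m}"]) auto
  have img: "placements n = ?f ` ?X"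
  proof (rule set_eqI)
    fix t :: "nat \<times> nat \<times> nat \<times> nat \<times> nat \<times> nat"
    obtain a b c p q r where t: "t = (a, b, c, p, q, r)" by (cases t)
    show "t \<in> placements n \<longleftrightarrow> t \<in> ?f ` ?X"
    proof
      assume "t \<in> placements n"
      then have "(n - (a + b + c), (a, b, c), (p, q, r)) \<in> ?X"
        by (auto simp: t placements_def shapes_def)
      then show "t \<in> ?f ` ?X" by (rule rev_image_eqI) (simp add: t)
    next
      assume "t \<in> ?f ` ?X"
      then obtain s where "s \<le> n" "a + b + c = n - s" "one_side_zero s p q r"
        by (auto simp: t shapes_def)
      moreover from this have "n - (a + b + c) = s" by simp
      ultimately show "t \<in> placements n"
        by (simp add: t placements_def)
    qed
  qed
  have inj: "inj_on ?f ?X" by (auto simp: inj_on_def)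
  have finX: "finite ?X" using fin by auto
  have "card ?X = (\<Sum>s\<le>n. ((n - s + 2) choose 2) * card (shapes s))"
    using fin by (simp add: card_sum_eq_3 card_cartesian_product)
  then show ?thesis
    using finX by (simp only: img card_image [OF inj]) simp
qed

text \<open>By Pascal's rule the quadratic weights are a threefold iterated summation, so
  \<open>P\<close>, \<open>Q\<close>, \<open>R\<close> are successive partial sums starting from
  \<open>g\<close>.\<close>

lemma placements_recurrence:
  fixes g :: "nat \<Rightarrow> real"
  defines "P \<equiv> \<lambda>n. \<Sum>s\<le>n. real ((n - s + 2) choose 2) * g s"
    and "Q \<equiv> \<lambda>n. \<Sum>s\<le>n. real (n - s + 1) * g s"
    and "R \<equiv> \<lambda>n. \<Sum>s\<le>n. g s"
  shows "P (Suc n) = P n + Q (Suc n)" "Q (Suc n) = Q n + R (Suc n)" "R (Suc n) = R n + g (Suc n)"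
proof -
  have "real ((Suc n - s + 2) choose 2) * g s
      = real ((n - s + 2) choose 2) * g s + real (Suc n - s + 1) * g s" if "s \<le> n" for s
    using that by (simp add: Suc_diff_le numeral_2_eq_2 algebra_simps)
  then show "P (Suc n) = P n + Q (Suc n)"
    by (simp add: P_def Q_def sum.distrib numeral_2_eq_2)
  have "real (Suc n - s + 1) * g s = real (n - s + 1) * g s + g s" if "s \<le> n" for s
    using that by (simp add: Suc_diff_le algebra_simps)
  then show "Q (Suc n) = Q n + R (Suc n)"
    by (simp add: Q_def R_def sum.distrib)
  show "R (Suc n) = R n + g (Suc n)" by (simp add: R_def)
qed

lemma card_placements:
  "real (card (placements (2 * k + 1))) =
     1 / 10 * (12 * real k ^ 5 + 25 * real k ^ 4 + 5 * real k ^ 3 - 10 * real k ^ 2 - 2 * real k)"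
  "real (card (placements (2 * k))) =
     1 / 10 * (12 * real k ^ 5 - 5 * real k ^ 4 - 15 * real k ^ 3 + 5 * real k ^ 2 + 3 * real k)"
proof -
  define g where "g s = real (card (shapes s))" for s
  define P where "P n = (\<Sum>s\<le>n. real ((n - s + 2) choose 2) * g s)" for n
  define Q where "Q n = (\<Sum>s\<le>n. real (n - s + 1) * g s)" for n
  define R where "R n = (\<Sum>s\<le>n. g s)" for n
  note rec = placements_recurrence [where g = g, folded P_def Q_def R_def]
  \<comment> \<open>At \<open>k = 0\<close> this polynomial would give 6, whereas
    \<open>g 0 = 0\<close>.\<close>
  have g_even: "g (2 * k) = 3 * (real k - 1) * (3 * real k - 2)" if "k \<ge> 1" for k
    using that unfolding g_def card_shapes card_pairs by (cases k) (simp_all add: power2_eq_square algebra_simps)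
  have g_odd: "g (Suc (2 * k)) = 3 * real k * (3 * real k - 2)" for k
    unfolding g_def card_shapes card_pairs by (cases k) (simp_all add: power2_eq_square algebra_simps)
  \<comment> \<open>The step from \<open>2 * k\<close> to \<open>2 * k + 2\<close> for
    \<open>P\<close> uses \<open>Q\<close>, and that for \<open>Q\<close> uses \<open>R\<close>, so
    the three closed forms are proved together.\<close>
  have closed: "R (2 * k) = 6 * real k ^ 3 - 21 / 2 * real k ^ 2 + 9/2 * real k \<and>
     Q (2 * k) = 3 * real k ^ 4 - 4 * real k ^ 3  + real k \<and>
     P (2 * k) = 1 / 10 * (12 * real k ^ 5 - 5 * real k ^ 4 - 15 * real k ^ 3 + 5 * real k ^ 2 + 3 * real k)" for k
  proof (induction k)
    case 0
    have "g 0 = 0" using card_pairs(1,3)[of 0] by (simp add: g_def card_shapes)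
    then show ?case by (simp add: P_def Q_def R_def)
  next
    case (Suc k)
    have "g (Suc (Suc (2 * k))) = 3 * real k * (3 * real k + 1)"
      using g_even [of "Suc k"] by (simp add: algebra_simps)
    then show ?case
      using Suc by (simp add: rec g_odd) (simp add: field_simps eval_nat_numeral)
  qed
  have P: "real (card (placements n)) = P n" for n
    by (simp add: card_placements_sum P_def g_def del: binomial_Suc_Suc)
  show "real (card (placements (2 * k))) =
     1 / 10 * (12 * real k ^ 5 - 5 * real k ^ 4 - 15 * real k ^ 3 + 5 * real k ^ 2 + 3 * real k)"
    using closed by (simp add: P)
  show "real (card (placements (2 * k + 1))) =
     1 / 10 * (12 * real k ^ 5 + 25 * real k ^ 4 + 5 * real k ^ 3 - 10 * real k ^ 2 - 2 * real k)"
    using closed [of k] by (simp add: P rec g_odd) (simp add: field_simps eval_nat_numeral)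
qed

section \<open>Corners of the hexagon\<close>

definition sides_nonneg :: "real \<Rightarrow> real \<Rightarrow> real \<Rightarrow> real \<Rightarrow> bool" where
  "sides_nonneg s p q r \<longleftrightarrow> 0 \<le> p \<and> 0 \<le> q \<and> 0 \<le> r \<and> p + q \<le> s \<and> q + r \<le> s \<and> r + p \<le> s"

text \<open>Barycentric coordinates in cyclic order. The sides between neighbours have lengths
  \<open>s - q - r\<close>, \<open>r\<close>, \<open>s - r - p\<close>, \<open>p\<close>,
  \<open>s - p - q\<close>, \<open>q\<close>, the last one closing the cycle.\<close>

definition corners :: "real \<Rightarrow> real \<Rightarrow> real \<Rightarrow> real \<Rightarrow> real \<Rightarrow> real \<Rightarrow> real \<Rightarrow> (real \<times> real \<times> real) set" where
  "corners s a b c p q r =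
     {(a, b + s - q, c + q), (a, b + r, c + s - r), (a + r, b, c + s - r),
      (a + s - p, b, c + p), (a + s - p, b + p, c), (a + q, b + s - q, c)}"

lemma card_5_iff: "card {u1, u2, u3, u4, u5} = 5 \<longleftrightarrow> distinct [u1, u2, u3, u4, u5]"
  using card_distinct [of "[u1, u2, u3, u4, u5]"] distinct_card [of "[u1, u2, u3, u4, u5]"]
  by (auto simp del: distinct.simps)

text \<open>Neighbouring corners merge when the side between them vanishes. If some side is zero,
  five names remain, and they are distinct iff no second side is zero; if none is zero there are six
  corners.\<close>

lemma card_corners:
  assumes "sides_nonneg s p q r"
  shows "card (corners s a b c p q r) = 5 \<longleftrightarrow> one_side_zero s p q r"
proof -
  note nonneg = assms [unfolded sides_nonneg_def]
  consider "p = 0" | "q = 0" | "r = 0" | "q + r = s" | "r + p = s" | "p + q = s"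
    | "0 < p" "0 < q" "0 < r" "q + r < s" "r + p < s" "p + q < s"
    using nonneg by linarith
  then show ?thesis
  proof cases
    case 1
    then have eq: "corners s a b c p q r = {(a, b + s - q, c + q), (a, b + r, c + s - r),
        (a + r, b, c + s - r), (a + s, b, c), (a + q, b + s - q, c)}"
      by (simp add: corners_def)
    show ?thesis unfolding eq card_5_iff one_side_zero_def using 1 nonneg by (simp, argo)
  next
    case 2
    then have eq: "corners s a b c p q r = {(a, b + s, c), (a, b + r, c + s - r),
        (a + r, b, c + s - r), (a + s - p, b, c + p), (a + s - p, b + p, c)}"
      by (auto simp: corners_def algebra_simps)
    show ?thesis unfolding eq card_5_iff one_side_zero_def using 2 nonneg by (simp, argo)
  next
    case 3
    then have eq: "corners s a b c p q r = {(a, b + s - q, c + q), (a, b, c + s),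
        (a + s - p, b, c + p), (a + s - p, b + p, c), (a + q, b + s - q, c)}"
      by (auto simp: corners_def algebra_simps)
    show ?thesis unfolding eq card_5_iff one_side_zero_def using 3 nonneg by (simp, argo)
  next
    case 4
    then have "b + s - q = b + r" "c + s - r = c + q" by simp_all
    then have eq: "corners s a b c p q r = {(a, b + r, c + q), (a + r, b, c + q),
        (a + s - p, b, c + p), (a + s - p, b + p, c), (a + q, b + r, c)}"
      by (simp only: corners_def insert_absorb2)
    show ?thesis unfolding eq card_5_iff one_side_zero_def using 4 nonneg by (simp, argo)
  next
    case 5
    then have "a + s - p = a + r" "c + s - r = c + p" by simp_all
    then have eq: "corners s a b c p q r = {(a, b + s - q, c + q), (a, b + r, c + p), (a + r, b, c + p),
        (a + r, b + p, c), (a + q, b + s - q, c)}"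
      by (simp only: corners_def insert_absorb2)
    show ?thesis unfolding eq card_5_iff one_side_zero_def using 5 nonneg by (simp, argo)
  next
    case 6
    then have "a + s - p = a + q" "b + s - q = b + p" by simp_all
    then have eq: "corners s a b c p q r = {(a, b + p, c + q), (a, b + r, c + s - r), (a + r, b, c + s - r),
        (a + q, b, c + p), (a + q, b + p, c)}"
      by (simp only: corners_def insert_absorb2)
    show ?thesis unfolding eq card_5_iff one_side_zero_def using 6 nonneg by (simp, argo)
  next
    case 7
    then have "card (corners s a b c p q r) = 6"
      by (auto simp: corners_def)
    then show ?thesis using 7 by (auto simp: one_side_zero_def)
  qed
qed

section \<open>Edges of polygons in the plane\<close>

text \<open>The determinant, twice the signed area of the triangle spanned by the two
  vectors.\<close>

definition cross2 :: "real^2 \<Rightarrow> real^2 \<Rightarrow> real" where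
  "cross2 u v = u $ 1 * v $ 2 - u $ 2 * v $ 1"

lemma cross2_eq_0D:
  assumes "cross2 u v = 0" "u \<noteq> 0"
  obtains t where "v = t *\<^sub>R u"
proof (cases "u $ 1 = 0")
  case True
  with assms have "u $ 2 \<noteq> 0" "v $ 1 = 0"
    by (auto simp: vec_eq_iff forall_2 cross2_def)
  with True have "v = (v $ 2 / u $ 2) *\<^sub>R u"
    by (auto simp: vec_eq_iff forall_2)
  then show ?thesis by (rule that)
next
  case False
  with assms have "v = (v $ 1 / u $ 1) *\<^sub>R u"
    by (auto simp: vec_eq_iff forall_2 cross2_def field_simps)
  then show ?thesis by (rule that)
qed

lemma collinear_if_cross2_eq_0:
  assumes "cross2 (B - A) (C - A) = 0"
  shows "collinear {A, B, C}"
proof (cases "B = A")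
  case False
  with assms obtain t where "C - A = t *\<^sub>R (B - A)"
    by (auto elim: cross2_eq_0D [of "B - A"])
  then have "collinear {0, B - A, C - A}"
    by (auto simp: collinear_lemma)
  then have "collinear {B, A, C}"
    by (subst collinear_3) (simp add: insert_commute)
  then show ?thesis by (simp add: insert_commute)
qed simp

lemma inner_real2: "u \<bullet> v = u $ 1 * v $ 1 + u $ 2 * v $ 2" for u v :: "real^2"
  by (simp add: inner_vec_def sum_2)

lemma orthogonal_to_common_real2:
  fixes a w d :: "real^2"
  assumes "a \<bullet> d = 0" "w \<bullet> d = 0" "d \<noteq> 0" "w \<noteq> 0"
  obtains t where "a = t *\<^sub>R w"
proof -
  have "d $ 1 * cross2 w a = 0" "d $ 2 * cross2 w a = 0"
    using assms(1,2) unfolding inner_real2 cross2_def by algebra+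
  then have "cross2 w a = 0"
    using \<open>d \<noteq> 0\<close> by (auto simp: vec_eq_iff forall_2)
  then show ?thesis
    using that \<open>w \<noteq> 0\<close> by (auto elim: cross2_eq_0D)
qed

text \<open>An edge of a two-dimensional polytope is a facet, cut out by some supporting line. It
  has two distinct points, so any line containing it is that supporting line; the normals differ by
  a factor \<open>t\<close> of unknown sign, whence the two alternatives. An interior point of
  \<open>S\<close> on the line would lie in the proper face \<open>e\<close>, which misses the
  relative interior.\<close>

lemma edge_line_supports:
  fixes S e :: "(real^2) set"
  assumes S: "polytope S" "aff_dim S = 2" and e: "e edge_of S"
    and w: "w \<noteq> 0" "e \<subseteq> {P. w \<bullet> P = c}"
  shows "S \<subseteq> {P. w \<bullet> P \<le> c} \<or> S \<subseteq> {P. c \<le> w \<bullet> P}"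
    and "{P. w \<bullet> P = c} \<inter> interior S = {}"
proof -
  have facet: "e facet_of S"
    using e S by (auto simp: edge_of_def facet_of_def)
  obtain a b where ab: "a \<noteq> 0" "S \<subseteq> {x. a \<bullet> x \<le> b}" "e = S \<inter> {x. a \<bullet> x = b}"
    using facet_of_polyhedron [OF polytope_imp_polyhedron [OF S(1)] facet] .
  have "aff_dim e = 1" using e by (simp add: edge_of_def)
  then obtain u v where uv: "u \<in> e" "v \<in> e" "u \<noteq> v"
  proof -
    have "\<not> e \<subseteq> {u}" for u
      using \<open>aff_dim e = 1\<close> aff_dim_subset [of e "{u}"] by auto
    then show ?thesis using that by blast
  qed
  have "a \<bullet> (u - v) = 0" "w \<bullet> (u - v) = 0"
    using uv ab(3) w(2) by (auto simp: inner_diff_right)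
  then obtain t where t: "a = t *\<^sub>R w"
    using orthogonal_to_common_real2 uv(3) w(1) by (metis right_minus_eq)
  have "t \<noteq> 0" using t ab(1) by auto
  have b: "b = t * c"
    using uv(1) ab(3) w(2) by (auto simp: t)
  show "S \<subseteq> {P. w \<bullet> P \<le> c} \<or> S \<subseteq> {P. c \<le> w \<bullet> P}"
  proof -
    have *: "t * (w \<bullet> P) \<le> t * c" if "P \<in> S" for P
      using ab(2) that by (auto simp: t b)
    consider "t > 0" | "t < 0" using \<open>t \<noteq> 0\<close> by linarith
    then show ?thesis
    proof cases
      case 1
      then have "S \<subseteq> {P. w \<bullet> P \<le> c}" using * by (simp add: subset_iff)
      then show ?thesis ..
    next
      case 2
      then have "S \<subseteq> {P. c \<le> w \<bullet> P}" using * by (simp add: subset_iff)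
      then show ?thesis ..
    qed
  qed
  show "{P. w \<bullet> P = c} \<inter> interior S = {}"
  proof (rule ccontr)
    assume "{P. w \<bullet> P = c} \<inter> interior S \<noteq> {}"
    then obtain q where q: "w \<bullet> q = c" "q \<in> interior S" by auto
    then have "q \<in> e"
      using ab(3) interior_subset by (auto simp: t b)
    moreover have "q \<in> rel_interior S"
      using q(2) interior_subset_rel_interior by blast
    moreover have "e \<noteq> S"
      using \<open>aff_dim e = 1\<close> S(2) by auto
    ultimately show False
      using face_of_disjoint_rel_interior e unfolding edge_of_def by blast
  qed
qed

text \<open>A segment from an interior point \<open>q\<close> to \<open>P\<close> meets the boundary
  at a point \<open>m\<close> of some facet \<open>e\<close>. The line of \<open>e\<close> passes
  through \<open>m\<close> but not through \<open>q\<close>, so \<open>P\<close> lies strictly on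
  the other side. Quantifying over all equations of that line allows it to be used with any
  coordinate.\<close>

lemma edge_separates_outer_point:
  fixes S :: "(real^2) set"
  assumes S: "polytope S" "aff_dim S = 2" and P: "P \<notin> S"
  obtains e where "e edge_of S"
    "\<And>w c. w \<noteq> 0 \<Longrightarrow> e \<subseteq> {X. w \<bullet> X = c} \<Longrightarrow>
       (\<forall>X\<in>S. w \<bullet> X \<le> c) \<and> c < w \<bullet> P \<or> (\<forall>X\<in>S. c \<le> w \<bullet> X) \<and> w \<bullet> P < c"
proof -
  have int: "rel_interior S = interior S"
    using S(2) by (intro interior_rel_interior) simp
  have "rel_interior S \<noteq> {}"
    using S by (auto simp: rel_interior_eq_empty polytope_imp_convex)
  then obtain q where q: "q \<in> interior S" using int by auto
  then have "q \<in> S" using interior_subset by auto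
  then have "closed_segment q P \<inter> frontier S \<noteq> {}"
    using P by (intro connected_Int_frontier) auto
  then obtain m where m: "m \<in> closed_segment q P" "m \<in> frontier S" by auto
  have mS: "m \<in> S - interior S"
    using m(2) S(1) by (simp add: frontier_def polytope_imp_closed closure_closed)
  then have "m \<in> \<Union> {F. F facet_of S}"
    using rel_boundary_of_polyhedron [OF polytope_imp_polyhedron [OF S(1)]] int by auto
  then obtain e where e: "e facet_of S" "m \<in> e" by auto
  then have edge: "e edge_of S"
    using S(2) by (auto simp: edge_of_def facet_of_def)
  obtain t where t: "0 \<le> t" "t \<le> 1" "m = (1 - t) *\<^sub>R q + t *\<^sub>R P"
    using m(1) by (auto simp: in_segment)
  have "t \<noteq> 0" using t(3) q mS by auto
  with t(1) have "t > 0" by simp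
  show ?thesis
  proof (rule that [OF edge])
    fix w c assume w: "w \<noteq> (0 :: real^2)" "e \<subseteq> {X. w \<bullet> X = c}"
    note supp = edge_line_supports [OF S edge w]
    have "w \<bullet> q \<noteq> c" using supp(2) q by auto
    have "w \<bullet> m = c" using w e by auto
    then have "(1 - t) * (w \<bullet> q) + t * (w \<bullet> P) = c"
      by (simp add: t(3) inner_add_right)
    \<comment> \<open>Since \<open>m\<close> is on the line, the signed distances of
      \<open>q\<close> and \<open>P\<close> from it have opposite signs.\<close>
    then have *: "t * (w \<bullet> P - c) = (1 - t) * (c - w \<bullet> q)"
      by (simp add: algebra_simps)
    have "t \<noteq> 1" using t(3) P mS by auto
    with t(2) have "t < 1" by simp
    from supp(1) show "(\<forall>X\<in>S. w \<bullet> X \<le> c) \<and> c < w \<bullet> P \<or> (\<forall>X\<in>S. c \<le> w \<bullet> X) \<and> w \<bullet> P < c"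
    proof
      assume le: "S \<subseteq> {X. w \<bullet> X \<le> c}"
      then have "w \<bullet> q < c" using \<open>q \<in> S\<close> \<open>w \<bullet> q \<noteq> c\<close> by fastforce
      then have "0 < t * (w \<bullet> P - c)" unfolding * using \<open>t < 1\<close> by simp
      then show ?thesis using le \<open>t > 0\<close> by (auto simp: zero_less_mult_iff)
    next
      assume le: "S \<subseteq> {X. c \<le> w \<bullet> X}"
      then have "w \<bullet> q > c" using \<open>q \<in> S\<close> \<open>w \<bullet> q \<noteq> c\<close> by fastforce
      then have "t * (w \<bullet> P - c) < 0" unfolding * using \<open>t < 1\<close> by (simp add: mult_pos_neg)
      then show ?thesis using le \<open>t > 0\<close> by (auto simp: mult_less_0_iff)
    qed
  qed
qed

section \<open>Barycentric coordinates\<close>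

text \<open>The signed area of \<open>PBC\<close> relative to \<open>ABC\<close>, scaled so that it
  is \<open>n\<close> at \<open>A\<close> and 0 on \<open>BC\<close>. Rotating the vertices yields
  the other two coordinates.\<close>

definition bary :: "nat \<Rightarrow> real^2 \<Rightarrow> real^2 \<Rightarrow> real^2 \<Rightarrow> real^2 \<Rightarrow> real" where
  "bary n A B C P = real n * cross2 (B - P) (C - P) / cross2 (B - A) (C - A)"

text \<open>With the lower bounds alone, the first coordinate has maximum \<open>n - b - c\<close>,
  at a corner of the enclosing triangle; cutting off size \<open>p\<close> there lowers it by
  \<open>p\<close>.\<close>

definition hexagon ::
  "nat \<Rightarrow> real^2 \<Rightarrow> real^2 \<Rightarrow> real^2 \<Rightarrow> real \<Rightarrow> real \<Rightarrow> real \<Rightarrow> real \<Rightarrow> real \<Rightarrow> real \<Rightarrow> (real^2) set" where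
  "hexagon n A B C a b c p q r =
     {P. a \<le> bary n A B C P \<and> bary n A B C P \<le> real n - b - c - p \<and>
         b \<le> bary n B C A P \<and> bary n B C A P \<le> real n - c - a - q \<and>
         c \<le> bary n C A B P \<and> bary n C A B P \<le> real n - a - b - r}"

lemma hexagon_rotate: "hexagon n B C A b c a q r p = hexagon n A B C a b c p q r"
  by (auto simp: hexagon_def)

lemma cross2_rotate: "cross2 (C - B) (A - B) = cross2 (B - A) (C - A)"
  by (simp add: cross2_def algebra_simps)

lemma mix_eq_min:
  fixes t u v a :: real
  assumes "(1 - t) * u + t * v = a" "a \<le> u" "a \<le> v" "0 < t" "t < 1"
  shows "u = a" "v = a"
proof -
  have "(1 - t) * (u - a) + t * (v - a) = 0" using assms(1) by (simp add: algebra_simps)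
  moreover have "0 \<le> (1 - t) * (u - a)" "0 \<le> t * (v - a)" using assms by simp_all
  ultimately have "(1 - t) * (u - a) = 0" "t * (v - a) = 0" by linarith+
  then show "u = a" "v = a" using assms by simp_all
qed

locale net =
  fixes n :: nat and A B C :: "real^2"
  assumes n_pos: "n \<ge> 1" and noncollinear: "\<not> collinear {A, B, C}"
begin

abbreviation "x \<equiv> bary n A B C"
abbreviation "y \<equiv> bary n B C A"
abbreviation "z \<equiv> bary n C A B"

text \<open>Interpreting the locale for rotated vertices transfers facts about \<open>x\<close> to
  \<open>y\<close> and \<open>z\<close>.\<close>

lemma rotate: "net n B C A"
  using n_pos noncollinear by (simp add: net_def insert_commute)

lemma rotate2: "net n C A B"
  using n_pos noncollinear by (simp add: net_def insert_commute)

lemma cross2_nonzero: "cross2 (B - A) (C - A) \<noteq> 0"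
  using collinear_if_cross2_eq_0 noncollinear by auto

lemma sum_bary: "x P + y P + z P = n"
proof -
  let ?D = "cross2 (B - A) (C - A)"
  have "x P + y P + z P = n * (cross2 (B - P) (C - P) + cross2 (C - P) (A - P) + cross2 (A - P) (B - P)) / ?D"
    by (simp add: bary_def cross2_rotate [of C B A] cross2_rotate [of B A C] add_divide_distrib distrib_left)
  also have "cross2 (B - P) (C - P) + cross2 (C - P) (A - P) + cross2 (A - P) (B - P) = ?D"
    by (simp add: cross2_def algebra_simps)
  finally show ?thesis using cross2_nonzero by simp
qed

text \<open>Makes level sets of \<open>x\<close> hyperplanes with normal \<open>w\<close>, so that
  facts on halfspaces and supporting hyperplanes apply.\<close>

lemma bary_affine: "\<exists>w k. w \<noteq> 0 \<and> (\<forall>P. x P = w \<bullet> P + k)"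
proof (intro exI conjI allI)
  let ?D = "cross2 (B - A) (C - A)"
  show "x P = (n / ?D) *\<^sub>R vector [B $ 2 - C $ 2, C $ 1 - B $ 1] \<bullet> P + n * cross2 B C / ?D" for P
    using cross2_nonzero
    by (simp add: bary_def inner_real2 vector_2 field_simps) (simp add: cross2_def algebra_simps)
  show "(n / ?D) *\<^sub>R vector [B $ 2 - C $ 2, C $ 1 - B $ 1] \<noteq> (0::real^2)"
    using cross2_nonzero n_pos by (auto simp: vec_eq_iff forall_2 vector_2 cross2_def algebra_simps)
qed

lemma bary_mix: "x ((1 - t) *\<^sub>R P + t *\<^sub>R Q) = (1 - t) * x P + t * x Q"
proof -
  obtain w k where "w \<noteq> 0" "\<And>P. x P = w \<bullet> P + k" using bary_affine by blast
  then show ?thesis by (simp add: inner_add_right algebra_simps)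
qed

lemma bary_vertex: "x A = n" "x B = 0" "x C = 0"
  using cross2_nonzero by (simp_all add: bary_def cross2_def)

lemma bary_decompose: "P = (x P / n) *\<^sub>R A + (y P / n) *\<^sub>R B + (z P / n) *\<^sub>R C"
proof -
  let ?D = "cross2 (B - A) (C - A)"
  have "?D *\<^sub>R P = cross2 (B - P) (C - P) *\<^sub>R A + cross2 (C - P) (A - P) *\<^sub>R B + cross2 (A - P) (B - P) *\<^sub>R C"
    by (simp add: vec_eq_iff forall_2 cross2_def algebra_simps)
  then have "?D *\<^sub>R P = ?D *\<^sub>R ((x P / n) *\<^sub>R A + (y P / n) *\<^sub>R B + (z P / n) *\<^sub>R C)"
    using cross2_nonzero n_pos
    by (simp add: bary_def cross2_rotate [of C B A] cross2_rotate [of B A C] scaleR_add_right)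
  then show ?thesis using cross2_nonzero by (simp only: scaleR_cancel_left) simp
qed

lemma bary_inj:
  assumes "x P = x Q" "y P = y Q"
  shows "P = Q"
proof -
  have "z P = z Q"
    using sum_bary [of P] sum_bary [of Q] assms by simp
  then show ?thesis
    using bary_decompose [of P] bary_decompose [of Q] assms by simp
qed

lemma point_with_bary:
  assumes "\<alpha> + \<beta> + \<gamma> = real n"
  obtains P where "x P = \<alpha>" "y P = \<beta>" "z P = \<gamma>"
proof -
  interpret R: net n B C A by (rule rotate)
  interpret R2: net n C A B by (rule rotate2)
  define P where "P = (\<alpha> / n) *\<^sub>R A + (\<beta> / n) *\<^sub>R B + (\<gamma> / n) *\<^sub>R C"
  have one: "\<alpha> / n + \<beta> / n + \<gamma> / n = 1"
    using assms n_pos by (simp flip: add_divide_distrib)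
  \<comment> \<open>The weights add up to 1, so an affine function is determined at \<open>P\<close>
    by its values at the three vertices.\<close>
  have mix: "f P = \<alpha> / n * f A + \<beta> / n * f B + \<gamma> / n * f C"
    if "\<And>P. f P = w \<bullet> P + k" for f w k
  proof -
    have "f P = \<alpha> / n * (w \<bullet> A) + \<beta> / n * (w \<bullet> B) + \<gamma> / n * (w \<bullet> C) + k * (\<alpha> / n + \<beta> / n + \<gamma> / n)"
      unfolding that one by (simp add: P_def inner_add_right)
    then show ?thesis unfolding that by (simp add: algebra_simps)
  qed
  obtain w k where "w \<noteq> 0" "\<And>P. x P = w \<bullet> P + k" using bary_affine by blast
  from mix [OF this(2)] have "x P = \<alpha>" using n_pos by (simp add: bary_vertex)
  moreover obtain w k where "w \<noteq> 0" "\<And>P. y P = w \<bullet> P + k" using R.bary_affine by blast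
  from mix [OF this(2)] have "y P = \<beta>" using n_pos by (simp add: R.bary_vertex)
  moreover obtain w k where "w \<noteq> 0" "\<And>P. z P = w \<bullet> P + k" using R2.bary_affine by blast
  from mix [OF this(2)] have "z P = \<gamma>" using n_pos by (simp add: R2.bary_vertex)
  ultimately show ?thesis by (rule that)
qed

lemma continuous_on_bary: "continuous_on T x"
proof -
  obtain w k where "w \<noteq> 0" "\<And>P. x P = w \<bullet> P + k" using bary_affine by blast
  then have "x = (\<lambda>P. w \<bullet> P + k)" by auto
  then show ?thesis by (simp add: continuous_intros)
qed

lemma polyhedron_bary: "polyhedron {P. a \<le> x P}" "polyhedron {P. x P \<le> a}"
proof -
  obtain w k where w: "w \<noteq> 0" "\<And>P. x P = w \<bullet> P + k" using bary_affine by blast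
  have "{P. a \<le> x P} = {P. w \<bullet> P \<ge> a - k}" "{P. x P \<le> a} = {P. w \<bullet> P \<le> a - k}"
    by (auto simp: w(2))
  then show "polyhedron {P. a \<le> x P}" "polyhedron {P. x P \<le> a}"
    by (simp_all add: polyhedron_halfspace_ge polyhedron_halfspace_le)
qed

section \<open>Hexagons as polyhedra and their extreme points\<close>

lemma polyhedron_hexagon: "polyhedron (hexagon n A B C a b c p q r)"
proof -
  interpret R: net n B C A by (rule rotate)
  interpret R2: net n C A B by (rule rotate2)
  have "hexagon n A B C a b c p q r =
    {P. a \<le> x P} \<inter> {P. x P \<le> real n - b - c - p} \<inter> ({P. b \<le> y P} \<inter> {P. y P \<le> real n - c - a - q}) \<inter>
    ({P. c \<le> z P} \<inter> {P. z P \<le> real n - a - b - r})"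
    by (auto simp: hexagon_def)
  also have "polyhedron \<dots>"
    by (intro polyhedron_Int polyhedron_bary R.polyhedron_bary R2.polyhedron_bary)
  finally show ?thesis .
qed

lemma interior_hexagon:
  assumes "a < x P" "x P < real n - b - c - p" "b < y P" "y P < real n - c - a - q"
    "c < z P" "z P < real n - a - b - r"
  shows "P \<in> interior (hexagon n A B C a b c p q r)"
proof (rule interiorI)
  interpret R: net n B C A by (rule rotate)
  interpret R2: net n C A B by (rule rotate2)
  let ?U = "{P. a < x P} \<inter> {P. x P < real n - b - c - p} \<inter> ({P. b < y P} \<inter> {P. y P < real n - c - a - q}) \<inter>
    ({P. c < z P} \<inter> {P. z P < real n - a - b - r})"
  show "open ?U"
    by (intro open_Int open_Collect_less continuous_on_bary R.continuous_on_bary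
        R2.continuous_on_bary continuous_on_const)
  show "P \<in> ?U" using assms by auto
  show "?U \<subseteq> hexagon n A B C a b c p q r" by (auto simp: hexagon_def)
qed

text \<open>A proper mixture of two values attains a common bound only if both values do; negation
  turns the upper bound into a lower one.\<close>

lemma bary_tight_on_segment:
  assumes "v = (1 - t) *\<^sub>R P + t *\<^sub>R Q" "0 < t" "t < 1"
    and "a \<le> x P" "x P \<le> a'" "a \<le> x Q" "x Q \<le> a'" "x v = a \<or> x v = a'"
  shows "x P = x Q"
proof -
  have "(1 - t) * x P + t * x Q = a \<or> (1 - t) * (- x P) + t * (- x Q) = - a'"
    using assms(8) unfolding assms(1) bary_mix by (metis minus_add_distrib mult_minus_right)
  then show ?thesis
    using mix_eq_min [of t "x P" "x Q" a] mix_eq_min [of t "- x P" "- x Q" "- a'"] assms(2-7)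
    by (metis neg_le_iff_le neg_equal_iff_equal)
qed

text \<open>Along any segment of the hexagon with \<open>v\<close> inside, the two tight bounds fix
  \<open>x\<close> and \<open>y\<close>, so its ends coincide.\<close>

lemma extreme_point_if_two_tight:
  assumes v: "v \<in> hexagon n A B C a b c p q r"
    and "x v = a \<or> x v = real n - b - c - p" "y v = b \<or> y v = real n - c - a - q"
  shows "v extreme_point_of hexagon n A B C a b c p q r"
  unfolding extreme_point_of_def
proof (intro conjI ballI notI)
  interpret R: net n B C A by (rule rotate)
  fix P Q assume PQ: "P \<in> hexagon n A B C a b c p q r" "Q \<in> hexagon n A B C a b c p q r"
    and "v \<in> open_segment P Q"
  then obtain t where t: "P \<noteq> Q" "v = (1 - t) *\<^sub>R P + t *\<^sub>R Q" "0 < t" "t < 1"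
    by (auto simp: in_segment)
  have "x P = x Q" "y P = y Q"
    using PQ t assms
    by (auto simp: hexagon_def intro!: bary_tight_on_segment [of v t P Q a "real n - b - c - p"]
        R.bary_tight_on_segment [of v t P Q b "real n - c - a - q"])
  then show False using bary_inj t(1) by blast
qed (rule v)

text \<open>With slack in both \<open>y\<close> and \<open>z\<close>, the point can be shifted both
  ways along its line of constant \<open>x\<close> by the least slack \<open>e\<close>, and is the
  midpoint of the two shifted points.\<close>

lemma extreme_point_imp_tight:
  assumes "v extreme_point_of hexagon n A B C a b c p q r"
  shows "y v \<in> {b, real n - c - a - q} \<or> z v \<in> {c, real n - a - b - r}"
proof (rule ccontr)
  interpret R: net n B C A by (rule rotate)
  assume *: "\<not> ?thesis"
  have v: "v \<in> hexagon n A B C a b c p q r"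
    using assms by (simp add: extreme_point_of_def)
  define e where "e = Min {y v - b, real n - c - a - q - y v, z v - c, real n - a - b - r - z v}"
  have e: "0 < e" "e \<le> y v - b" "e \<le> real n - c - a - q - y v" "e \<le> z v - c" "e \<le> real n - a - b - r - z v"
    using v * by (auto simp: e_def hexagon_def)
  obtain P where P: "x P = x v" "y P = y v + e" "z P = z v - e"
    using point_with_bary [of "x v" "y v + e" "z v - e"] sum_bary [of v] by auto
  obtain Q where Q: "x Q = x v" "y Q = y v - e" "z Q = z v + e"
    using point_with_bary [of "x v" "y v - e" "z v + e"] sum_bary [of v] by auto
  have "P \<noteq> Q" using P Q e by auto
  moreover have "v = (1 - 1/2) *\<^sub>R P + (1/2) *\<^sub>R Q"
    by (rule bary_inj; simp only: bary_mix R.bary_mix P Q) (simp_all add: field_simps)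
  ultimately have "v \<in> open_segment P Q"
    unfolding in_segment by (intro conjI exI [of _ "1/2"]) auto
  moreover have "P \<in> hexagon n A B C a b c p q r" "Q \<in> hexagon n A B C a b c p q r"
    using v e P Q by (auto simp: hexagon_def)
  ultimately show False using assms by (auto simp: extreme_point_of_def)
qed

end

lemma one_side_zero_imp_sides_nonneg: "one_side_zero s p q r \<Longrightarrow> sides_nonneg s p q r"
  unfolding one_side_zero_def sides_nonneg_def by argo

lemma one_side_zero_of_nat:
  "one_side_zero (real s) (real p) (real q) (real r) \<longleftrightarrow> one_side_zero s p q r"
  unfolding one_side_zero_def by (simp flip: of_nat_add)

text \<open>The part of a coordinate line within the triangle; the third coordinate bound there
  follows from \<open>i\<close> being natural.\<close>

definition level :: "nat \<Rightarrow> real^2 \<Rightarrow> real^2 \<Rightarrow> real^2 \<Rightarrow> nat \<Rightarrow> (real^2) set" where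
  "level n A B C i = {P. bary n A B C P = real i \<and> 0 \<le> bary n B C A P \<and> 0 \<le> bary n C A B P}"

lemma triangular_net_rotate: "triangular_net n B C A = triangular_net n A B C"
  by (auto simp: triangular_net_def)

lemma real_nat_if_Ints_nonneg:
  fixes t :: real
  assumes "t \<in> \<int>" "0 \<le> t"
  shows "real (nat \<lfloor>t\<rfloor>) = t"
  using assms by (auto elim!: Ints_cases)

section \<open>Hexagons and the net\<close>

context net
begin

text \<open>Dividing points at fraction \<open>i / n\<close> from \<open>A\<close> have first
  coordinate \<open>n - i\<close>, and along the segment \<open>z\<close> grows from 0 to
  \<open>i\<close>, so \<open>z P / i\<close> is the segment parameter.\<close>

lemma joining_segment_eq:
  assumes "1 \<le> i" "i \<le> n"
  shows "closed_segment (div_point n A B i) (div_point n A C i) = level n A B C (n - i)"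
proof -
  interpret R: net n B C A by (rule rotate)
  interpret R2: net n C A B by (rule rotate2)
  let ?U = "div_point n A B i" and ?V = "div_point n A C i"
  have dp: "div_point n A Y i = (1 - real i / n) *\<^sub>R A + (real i / n) *\<^sub>R Y" for Y
    by (simp add: div_point_def algebra_simps)
  have U: "x ?U = real n - real i" "y ?U = i" "z ?U = 0"
    unfolding dp bary_mix R.bary_mix R2.bary_mix
    using n_pos by (simp_all add: bary_vertex R.bary_vertex R2.bary_vertex field_simps)
  have V: "x ?V = real n - real i" "y ?V = 0" "z ?V = i"
    unfolding dp bary_mix R.bary_mix R2.bary_mix
    using n_pos by (simp_all add: bary_vertex R.bary_vertex R2.bary_vertex field_simps)
  show ?thesis
  proof (intro equalityI subsetI)
    fix P assume "P \<in> closed_segment ?U ?V"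
    then obtain t where t: "0 \<le> t" "t \<le> 1" "P = (1 - t) *\<^sub>R ?U + t *\<^sub>R ?V"
      by (auto simp: in_segment)
    have "x P = real n - real i" "y P = (1 - t) * i" "z P = t * i"
      unfolding t(3) bary_mix R.bary_mix R2.bary_mix U V by (simp_all add: algebra_simps)
    then show "P \<in> level n A B C (n - i)"
      using t assms by (simp add: level_def of_nat_diff)
  next
    fix P assume "P \<in> level n A B C (n - i)"
    then have P: "x P = real n - real i" "0 \<le> y P" "0 \<le> z P"
      using assms by (auto simp: level_def of_nat_diff)
    have yz: "y P = i - z P" using sum_bary [of P] P(1) by simp
    define t where "t = z P / i"
    have t: "0 \<le> t" "t \<le> 1" "t * i = z P"
      using P yz assms by (simp_all add: t_def)
    have "P = (1 - t) *\<^sub>R ?U + t *\<^sub>R ?V"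
    proof (rule bary_inj)
      show "x P = x ((1 - t) *\<^sub>R ?U + t *\<^sub>R ?V)"
        unfolding bary_mix U V P by (simp add: algebra_simps)
      show "y P = y ((1 - t) *\<^sub>R ?U + t *\<^sub>R ?V)"
        unfolding R.bary_mix U V yz t(3) [symmetric] by (simp add: algebra_simps)
    qed
    then show "P \<in> closed_segment ?U ?V"
      using t by (auto simp: in_segment)
  qed
qed

text \<open>The edge \<open>BC\<close> is the joining segment for \<open>i = n\<close>, that is
  level 0. Level \<open>n\<close>, the single point \<open>A\<close>, does not occur.\<close>

lemma parallel_family_eq:
  "insert (closed_segment B C) (inner_segments n A B C) = level n A B C ` {..<n}"
proof -
  let ?g = "\<lambda>i. closed_segment (div_point n A B i) (div_point n A C i)"
  have "closed_segment B C = ?g n"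
    using n_pos by (simp add: div_point_def)
  moreover have "inner_segments n A B C = ?g ` {1..<n}"
    unfolding inner_segments_def by auto
  moreover have "{1..n} = insert n {1..<n}"
    using n_pos by auto
  ultimately have "insert (closed_segment B C) (inner_segments n A B C) = ?g ` {1..n}"
    by (simp only: image_insert)
  also have "\<dots> = (\<lambda>i. level n A B C (n - i)) ` {1..n}"
    by (intro image_cong) (auto simp: joining_segment_eq)
  also have "\<dots> = level n A B C ` (\<lambda>i. n - i) ` {1..n}"
    by (simp add: image_image)
  also have "(\<lambda>i. n - i) ` {1..n} = {..<n}"
  proof (intro equalityI subsetI)
    fix j assume "j \<in> {..<n}"
    then show "j \<in> (\<lambda>i. n - i) ` {1..n}" by (intro image_eqI [of _ _ "n - j"]) auto
  qed auto
  finally show ?thesis .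
qed

lemma triangular_net_eq:
  "triangular_net n A B C = level n A B C ` {..<n} \<union> level n B C A ` {..<n} \<union> level n C A B ` {..<n}"
proof -
  interpret R: net n B C A by (rule rotate)
  interpret R2: net n C A B by (rule rotate2)
  show ?thesis
    unfolding triangular_net_def parallel_family_eq [symmetric] R.parallel_family_eq [symmetric]
      R2.parallel_family_eq [symmetric] by auto
qed

text \<open>Two distinct points with equal \<open>x\<close> differ in \<open>y\<close> and in
  \<open>z\<close>, so a net segment through both must be a level of \<open>x\<close>.\<close>

lemma net_line_integral:
  assumes "s \<in> triangular_net n A B C" "U \<in> s" "V \<in> s" "U \<noteq> V" "x U = x V"
  shows "x U \<in> \<int>" "0 \<le> x U" "0 \<le> y U" "0 \<le> z U" "0 \<le> y V" "0 \<le> z V"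
proof -
  interpret R: net n B C A by (rule rotate)
  interpret R2: net n C A B by (rule rotate2)
  have "y U \<noteq> y V" using bary_inj assms by blast
  moreover have "z U \<noteq> z V" using R2.bary_inj assms by blast
  ultimately have *: "\<exists>i. s = level n A B C i"
    using assms by (auto simp: triangular_net_eq level_def)
  then show "x U \<in> \<int>" "0 \<le> x U" "0 \<le> y U" "0 \<le> z U" "0 \<le> y V" "0 \<le> z V"
    using assms by (auto simp: level_def)
qed

section \<open>Sides and corners of a hexagon\<close>

lemma supporting_line_face:
  assumes "convex H" "(\<forall>P\<in>H. a \<le> x P) \<or> (\<forall>P\<in>H. x P \<le> a)"
  shows "(H \<inter> {P. x P = a}) face_of H"
proof -
  obtain w k where w: "w \<noteq> 0" "\<And>P. x P = w \<bullet> P + k" using bary_affine by blast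
  have eq: "{P. x P = a} = {P. w \<bullet> P = a - k}" by (auto simp: w(2))
  from assms(2) show ?thesis
  proof
    assume "\<forall>P\<in>H. a \<le> x P"
    then show ?thesis unfolding eq
      by (intro face_of_Int_supporting_hyperplane_ge assms) (auto simp: w(2))
  next
    assume "\<forall>P\<in>H. x P \<le> a"
    then show ?thesis unfolding eq
      by (intro face_of_Int_supporting_hyperplane_le assms) (auto simp: w(2))
  qed
qed

lemma supporting_line_edge:
  assumes "convex H" "(\<forall>P\<in>H. a \<le> x P) \<or> (\<forall>P\<in>H. x P \<le> a)"
    and "U \<in> H" "V \<in> H" "U \<noteq> V" "x U = a" "x V = a"
  shows "(H \<inter> {P. x P = a}) edge_of H"
proof -
  obtain w k where w: "w \<noteq> 0" "\<And>P. x P = w \<bullet> P + k" using bary_affine by blast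
  have eq: "{P. x P = a} = {P. w \<bullet> P = a - k}" by (auto simp: w(2))
  have "aff_dim (H \<inter> {P. x P = a}) \<le> aff_dim {P. w \<bullet> P = a - k}"
    by (intro aff_dim_subset) (auto simp: eq)
  also have "\<dots> = 1" using w(1) by (simp add: aff_dim_hyperplane)
  finally have "aff_dim (H \<inter> {P. x P = a}) \<le> 1" .
  moreover have "aff_dim {U, V} \<le> aff_dim (H \<inter> {P. x P = a})"
    using assms by (intro aff_dim_subset) auto
  ultimately show ?thesis
    using supporting_line_face [OF assms(1,2)] assms(5) by (simp add: edge_of_def aff_dim_2)
qed

lemma convex_hexagon: "convex (hexagon n A B C a b c p q r)"
  by (simp add: polyhedron_hexagon polyhedron_imp_convex)

lemma corner_point:
  assumes "a + b + c + s = real n" "sides_nonneg s p q r" "t \<in> corners s a b c p q r"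
  obtains P where "P \<in> hexagon n A B C a b c p q r" "(x P, y P, z P) = t"
proof -
  obtain \<alpha> \<beta> \<gamma> where t: "t = (\<alpha>, \<beta>, \<gamma>)" by (cases t)
  have sum: "\<alpha> + \<beta> + \<gamma> = real n" using assms(1,3) by (auto simp: corners_def t)
  obtain P where P: "x P = \<alpha>" "y P = \<beta>" "z P = \<gamma>" by (rule point_with_bary [OF sum])
  have "P \<in> hexagon n A B C a b c p q r"
    using assms by (auto simp: hexagon_def P corners_def t sides_nonneg_def)
  then show ?thesis by (rule that) (simp add: P t)
qed

text \<open>Of any two coordinates of an extreme point one is tight, hence at least two of the three
  are tight, and linear arithmetic leaves only the six corners. Conversely each corner has two tight
  coordinates.\<close>

lemma extreme_point_hexagon:
  assumes s: "a + b + c + s = real n" and nonneg: "sides_nonneg s p q r"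
  shows "v extreme_point_of hexagon n A B C a b c p q r \<longleftrightarrow> (x v, y v, z v) \<in> corners s a b c p q r"
proof -
  interpret R: net n B C A by (rule rotate)
  interpret R2: net n C A B by (rule rotate2)
  have rot: "hexagon n B C A b c a q r p = hexagon n A B C a b c p q r"
    "hexagon n C A B c a b r p q = hexagon n A B C a b c p q r"
    by (simp_all add: hexagon_rotate)
  show ?thesis
  proof
    assume ext: "v extreme_point_of hexagon n A B C a b c p q r"
    have "v \<in> hexagon n A B C a b c p q r" using ext by (simp add: extreme_point_of_def)
    moreover note extreme_point_imp_tight [OF ext]
      R.extreme_point_imp_tight [of _ b c a q r p, unfolded rot, OF ext]
      R2.extreme_point_imp_tight [of _ c a b r p q, unfolded rot, OF ext]
    ultimately show "(x v, y v, z v) \<in> corners s a b c p q r"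
      using sum_bary [of v] s nonneg
      unfolding corners_def hexagon_def sides_nonneg_def mem_Collect_eq insert_iff empty_iff prod.inject
      by argo
  next
    assume *: "(x v, y v, z v) \<in> corners s a b c p q r"
    obtain P where P: "P \<in> hexagon n A B C a b c p q r" "(x P, y P, z P) = (x v, y v, z v)"
      using corner_point [OF assms *] by blast
    then have v: "v \<in> hexagon n A B C a b c p q r"
      using bary_inj by auto
    have "(x v = a \<or> x v = real n - b - c - p) \<and> (y v = b \<or> y v = real n - c - a - q) \<or>
        (y v = b \<or> y v = real n - c - a - q) \<and> (z v = c \<or> z v = real n - a - b - r) \<or>
        (z v = c \<or> z v = real n - a - b - r) \<and> (x v = a \<or> x v = real n - b - c - p)"
      using * s unfolding corners_def insert_iff empty_iff prod.inject by argo
    then show "v extreme_point_of hexagon n A B C a b c p q r"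
      using extreme_point_if_two_tight [OF v]
        R.extreme_point_if_two_tight [of v b c a q r p, unfolded rot, OF v]
        R2.extreme_point_if_two_tight [of v c a b r p q, unfolded rot, OF v] by blast
  qed
qed

lemma card_extreme_points_hexagon:
  assumes "a + b + c + s = real n" "sides_nonneg s p q r"
  shows "card {v. v extreme_point_of hexagon n A B C a b c p q r} = 5 \<longleftrightarrow> one_side_zero s p q r"
proof -
  let ?E = "{v. v extreme_point_of hexagon n A B C a b c p q r}"
  have "(\<lambda>v. (x v, y v, z v)) ` ?E = corners s a b c p q r"
  proof (intro equalityI subsetI)
    fix t assume t: "t \<in> corners s a b c p q r"
    obtain P where "P \<in> hexagon n A B C a b c p q r" "(x P, y P, z P) = t"
      by (rule corner_point [OF assms t])
    then show "t \<in> (\<lambda>v. (x v, y v, z v)) ` ?E"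
      using t extreme_point_hexagon [OF assms] by blast
  qed (use extreme_point_hexagon [OF assms] in auto)
  moreover have "inj_on (\<lambda>v. (x v, y v, z v)) ?E"
    using bary_inj by (auto simp: inj_on_def)
  ultimately have "card ?E = card (corners s a b c p q r)"
    using card_image by fastforce
  then show ?thesis using card_corners [OF assms(2)] by simp
qed

text \<open>\<open>U\<close>, \<open>V\<close> are the ends of the side on the lower bound of
  \<open>x\<close>, and \<open>U'\<close>, \<open>V'\<close> those of the side made by the cut
  \<open>p\<close>. They also witness that both bounds are attained.\<close>

lemma hexagon_side_ends:
  assumes "a + b + c + s = real n" "sides_nonneg s p q r"
  obtains U V U' V' where "{U, V, U', V'} \<subseteq> hexagon n A B C a b c p q r"
    "x U = a" "y U = b + s - q" "z U = c + q" "x V = a" "y V = b + r" "z V = c + s - r"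
    "x U' = real n - b - c - p" "y U' = b" "z U' = c + p"
    "x V' = real n - b - c - p" "y V' = b + p" "z V' = c"
proof -
  have c: "(a, b + s - q, c + q) \<in> corners s a b c p q r" "(a, b + r, c + s - r) \<in> corners s a b c p q r"
    "(a + s - p, b, c + p) \<in> corners s a b c p q r" "(a + s - p, b + p, c) \<in> corners s a b c p q r"
    by (auto simp: corners_def)
  obtain U where U: "U \<in> hexagon n A B C a b c p q r" "(x U, y U, z U) = (a, b + s - q, c + q)"
    by (rule corner_point [OF assms c(1)])
  obtain V where V: "V \<in> hexagon n A B C a b c p q r" "(x V, y V, z V) = (a, b + r, c + s - r)"
    by (rule corner_point [OF assms c(2)])
  obtain U' where U': "U' \<in> hexagon n A B C a b c p q r" "(x U', y U', z U') = (a + s - p, b, c + p)"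
    by (rule corner_point [OF assms c(3)])
  obtain V' where V': "V' \<in> hexagon n A B C a b c p q r" "(x V', y V', z V') = (a + s - p, b + p, c)"
    by (rule corner_point [OF assms c(4)])
  show ?thesis
    by (rule that [of U V U' V']) (use U V U' V' assms(1) in auto)
qed

text \<open>A side of positive length is an edge, so it lies on a net segment, necessarily a level
  of \<open>x\<close>. The signs of \<open>b\<close> and \<open>c\<close> come from the ends of the
  upper side, where \<open>y = b\<close> and \<open>z = c\<close>.\<close>

lemma hexagon_side_integral:
  assumes s: "a + b + c + s = real n" and nonneg: "sides_nonneg s p q r"
    and edges: "\<forall>e. e edge_of hexagon n A B C a b c p q r \<longrightarrow> (\<exists>s \<in> triangular_net n A B C. e \<subseteq> s)"
  shows "q + r < s \<Longrightarrow> a \<in> \<int> \<and> 0 \<le> a"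
    and "0 < p \<Longrightarrow> real n - b - c - p \<in> \<int> \<and> 0 \<le> b \<and> 0 \<le> c"
proof -
  let ?H = "hexagon n A B C a b c p q r"
  obtain U V U' V' where H: "{U, V, U', V'} \<subseteq> ?H"
    and U: "x U = a" "y U = b + s - q" "z U = c + q" and V: "x V = a" "y V = b + r" "z V = c + s - r"
    and U': "x U' = real n - b - c - p" "y U' = b" "z U' = c + p"
    and V': "x V' = real n - b - c - p" "y V' = b + p" "z V' = c"
    by (rule hexagon_side_ends [OF s nonneg])
  {
    assume "q + r < s"
    then have "U \<noteq> V" using U V by auto
    have "(?H \<inter> {P. x P = a}) edge_of ?H"
      by (rule supporting_line_edge [OF convex_hexagon _ _ _ \<open>U \<noteq> V\<close>]) (use H U V in \<open>auto simp: hexagon_def\<close>)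
    then obtain l where l: "l \<in> triangular_net n A B C" "?H \<inter> {P. x P = a} \<subseteq> l" using edges by blast
    then have "U \<in> l" "V \<in> l" using H U V by auto
    from net_line_integral [OF l(1) this \<open>U \<noteq> V\<close>] show "a \<in> \<int> \<and> 0 \<le> a"
      using U V by simp
  next
    assume "0 < p"
    then have "U' \<noteq> V'" using U' V' by auto
    have "(?H \<inter> {P. x P = real n - b - c - p}) edge_of ?H"
      by (rule supporting_line_edge [OF convex_hexagon _ _ _ \<open>U' \<noteq> V'\<close>]) (use H U' V' in \<open>auto simp: hexagon_def\<close>)
    then obtain l where l: "l \<in> triangular_net n A B C" "?H \<inter> {P. x P = real n - b - c - p} \<subseteq> l"
      using edges by blast
    then have "U' \<in> l" "V' \<in> l" using H U' V' by auto
    from net_line_integral [OF l(1) this \<open>U' \<noteq> V'\<close>] show "real n - b - c - p \<in> \<int> \<and> 0 \<le> b \<and> 0 \<le> c"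
      using U' V' by simp
  }
qed

section \<open>Net pentagons are hexagons with natural parameters\<close>

lemma bary_attains_bounds:
  assumes "compact S" "S \<noteq> {}"
  obtains P Q where "P \<in> S" "Q \<in> S" "\<And>X. X \<in> S \<Longrightarrow> x P \<le> x X" "\<And>X. X \<in> S \<Longrightarrow> x X \<le> x Q"
  using continuous_attains_inf [OF assms continuous_on_bary]
    continuous_attains_sup [OF assms continuous_on_bary] by blast

text \<open>The hexagon is cut out by the extreme coordinate values on \<open>S\<close>. A point of
  it outside \<open>S\<close> would be separated from \<open>S\<close> by the line of an edge; that
  line is a level of \<open>x\<close>, \<open>y\<close> or \<open>z\<close>, so the point would
  violate an extreme value of this coordinate.\<close>

lemma net_polygon_is_hexagon:
  assumes S: "polytope S" "aff_dim S = 2"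
    and edges: "\<forall>e. e edge_of S \<longrightarrow> (\<exists>s \<in> triangular_net n A B C. e \<subseteq> s)"
  obtains a b c s p q r where "a + b + c + s = real n" "sides_nonneg s p q r"
    "S = hexagon n A B C a b c p q r"
proof -
  interpret R: net n B C A by (rule rotate)
  interpret R2: net n C A B by (rule rotate2)
  have S': "compact S" "S \<noteq> {}" using S by (auto simp: polytope_imp_compact)
  obtain X1 X2 where X: "X1 \<in> S" "X2 \<in> S" "\<And>P. P \<in> S \<Longrightarrow> x X1 \<le> x P" "\<And>P. P \<in> S \<Longrightarrow> x P \<le> x X2"
    using bary_attains_bounds [OF S'] by metis
  obtain Y1 Y2 where Y: "Y1 \<in> S" "Y2 \<in> S" "\<And>P. P \<in> S \<Longrightarrow> y Y1 \<le> y P" "\<And>P. P \<in> S \<Longrightarrow> y P \<le> y Y2"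
    using R.bary_attains_bounds [OF S'] by metis
  obtain Z1 Z2 where Z: "Z1 \<in> S" "Z2 \<in> S" "\<And>P. P \<in> S \<Longrightarrow> z Z1 \<le> z P" "\<And>P. P \<in> S \<Longrightarrow> z P \<le> z Z2"
    using R2.bary_attains_bounds [OF S'] by metis
  define a b c where "a = x X1" and "b = y Y1" and "c = z Z1"
  define s p q r where "s = n - a - b - c" and "p = n - b - c - x X2"
    and "q = n - c - a - y Y2" and "r = n - a - b - z Z2"
  note defs = a_def b_def c_def s_def p_def q_def r_def
  have H: "hexagon n A B C a b c p q r = {P. x X1 \<le> x P \<and> x P \<le> x X2 \<and> y Y1 \<le> y P \<and> y P \<le> y Y2 \<and>
      z Z1 \<le> z P \<and> z P \<le> z Z2}"
    by (simp add: hexagon_def defs)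
  have "a + b + c + s = n" by (simp add: s_def)
  \<comment> \<open>For instance \<open>0 \<le> p\<close> comes from the coordinate sum at
    \<open>X2\<close>, and \<open>p + q \<le> s\<close> from the sum at \<open>Z1\<close>, where
    \<open>x + y = n - c\<close>.\<close>
  moreover have "sides_nonneg s p q r"
    unfolding sides_nonneg_def defs
    using X(3,4)[OF Y(1)] X(3,4)[OF Y(2)] X(3,4)[OF Z(1)] X(3,4)[OF Z(2)]
      Y(3,4)[OF X(1)] Y(3,4)[OF X(2)] Y(3,4)[OF Z(1)] Y(3,4)[OF Z(2)]
      Z(3,4)[OF Y(1)] Z(3,4)[OF Y(2)] Z(3,4)[OF X(1)] Z(3,4)[OF X(2)]
      sum_bary [of X1] sum_bary [of X2] sum_bary [of Y1] sum_bary [of Y2] sum_bary [of Z1] sum_bary [of Z2]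
    by (intro conjI) linarith+
  moreover have "S = hexagon n A B C a b c p q r"
  proof (intro equalityI subsetI)
    fix P assume "P \<in> S" then show "P \<in> hexagon n A B C a b c p q r"
      using X Y Z by (auto simp: H)
  next
    fix P assume P: "P \<in> hexagon n A B C a b c p q r"
    show "P \<in> S"
    proof (rule ccontr)
      assume "P \<notin> S"
      then obtain e where e: "e edge_of S"
        "\<And>w c. w \<noteq> 0 \<Longrightarrow> e \<subseteq> {X. w \<bullet> X = c} \<Longrightarrow>
          (\<forall>X\<in>S. w \<bullet> X \<le> c) \<and> c < w \<bullet> P \<or> (\<forall>X\<in>S. c \<le> w \<bullet> X) \<and> w \<bullet> P < c"
        using edge_separates_outer_point [OF S] by blast
      have sep: "(\<forall>X\<in>S. f X \<le> i) \<and> i < f P \<or> (\<forall>X\<in>S. i \<le> f X) \<and> f P < i"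
        if f: "\<exists>w k. w \<noteq> 0 \<and> (\<forall>P. f P = w \<bullet> P + k)" and "e \<subseteq> {X. f X = i}" for f and i :: real
      proof -
        from f obtain w k where w: "w \<noteq> 0" "\<And>P. f P = w \<bullet> P + k" by blast
        then have "e \<subseteq> {X. w \<bullet> X = i - k}" using that(2) by auto
        from e(2) [OF w(1) this] show ?thesis by (auto simp: w(2))
      qed
      obtain l where l: "l \<in> triangular_net n A B C" "e \<subseteq> l" using edges e(1) by blast
      then consider i where "e \<subseteq> {P. x P = real i}" | i where "e \<subseteq> {P. y P = real i}"
        | i where "e \<subseteq> {P. z P = real i}"
        unfolding triangular_net_eq level_def by blast
      then show False
      proof cases
        case 1
        from sep [OF bary_affine 1] show False using X(1,2) P unfolding H by force
      next
        case 2
        from sep [OF R.bary_affine 2] show False using Y(1,2) P unfolding H by force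
      next
        case 3
        from sep [OF R2.bary_affine 3] show False using Z(1,2) P unfolding H by force
      qed
    qed
  qed
  ultimately show ?thesis by (rule that)
qed

text \<open>The five positive sides put five of the six bounds on net lines. If a cut is absent, all
  three lower bounds are among them; otherwise the missing lower bound is recovered from two upper
  bounds.\<close>

lemma net_pentagon_integral:
  assumes s: "a + b + c + s = real n" and zero: "one_side_zero s p q r"
    and edges: "\<forall>e. e edge_of hexagon n A B C a b c p q r \<longrightarrow> (\<exists>s \<in> triangular_net n A B C. e \<subseteq> s)"
  shows "{a, b, c, p, q, r} \<subseteq> \<int> \<inter> {0..}"
proof -
  interpret R: net n B C A by (rule rotate)
  interpret R2: net n C A B by (rule rotate2)
  have nonneg: "sides_nonneg s p q r"
    using zero by (rule one_side_zero_imp_sides_nonneg)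
  have rot: "hexagon n B C A b c a q r p = hexagon n A B C a b c p q r"
    "hexagon n C A B c a b r p q = hexagon n A B C a b c p q r"
    "triangular_net n B C A = triangular_net n A B C" "triangular_net n C A B = triangular_net n A B C"
    by (simp_all add: hexagon_rotate triangular_net_rotate)
  have s2: "b + c + a + s = real n" "c + a + b + s = real n" using s by simp_all
  have nonneg2: "sides_nonneg s q r p" "sides_nonneg s r p q"
    using nonneg by (auto simp: sides_nonneg_def)
  note X = hexagon_side_integral [OF s nonneg edges]
  note Y = R.hexagon_side_integral [OF s2(1) nonneg2(1), unfolded rot, OF edges]
  note Z = R2.hexagon_side_integral [OF s2(2) nonneg2(2), unfolded rot, OF edges]
  have N: "real n \<in> \<int>" by simp
  have low: ?thesis if abc: "a \<in> \<int>" "b \<in> \<int>" "c \<in> \<int>" "0 \<le> a" "0 \<le> b" "0 \<le> c"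
    and high: "p = 0 \<or> real n - b - c - p \<in> \<int>" "q = 0 \<or> real n - c - a - q \<in> \<int>"
      "r = 0 \<or> real n - a - b - r \<in> \<int>"
  proof -
    have "t \<in> \<int>" if "u \<in> \<int>" "v \<in> \<int>" "t = 0 \<or> real n - u - v - t \<in> \<int>" for t u v :: real
      using that Ints_diff [OF Ints_diff [OF Ints_diff [OF N that(1)] that(2)], of "real n - u - v - t"]
      by auto
    then have "p \<in> \<int>" "q \<in> \<int>" "r \<in> \<int>" using that by blast+
    then show ?thesis using abc nonneg by (auto simp: sides_nonneg_def)
  qed
  \<comment> \<open>The side on the lower bound \<open>u\<close> has shrunk to a point where the
    other two coordinates attain their upper bounds, so \<open>u\<close> is \<open>n\<close> minus
    these.\<close>
  have corner: "u \<in> \<int>"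
    if "u + v + w + s = real n" "j + k = s" "real n - w - u - j \<in> \<int>" "real n - u - v - k \<in> \<int>"
    for u v w j k :: real
  proof -
    have "u = real n - (real n - w - u - j) - (real n - u - v - k)" using that by simp
    then show ?thesis by (metis Ints_diff N that(3,4))
  qed
  from zero show ?thesis unfolding one_side_zero_def
  proof (elim disjE conjE)
    assume "p = 0" "0 < q" "0 < r" "q + r < s"
    then show ?thesis using X Y Z by (intro low) auto
  next
    assume "q = 0" "0 < r" "0 < p" "r + p < s"
    then show ?thesis using X Y Z by (intro low) auto
  next
    assume "r = 0" "0 < p" "0 < q" "p + q < s"
    then show ?thesis using X Y Z by (intro low) auto
  next
    assume *: "q + r = s" "0 < p" "p < q" "p < r"
    then have "r + p < s" "p + q < s" "0 < q" "0 < r" by simp_all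
    note X(2) [OF *(2)] Y(1) [OF this(1)] Z(1) [OF this(2)] Y(2) [OF this(3)] Z(2) [OF this(4)]
    moreover from this have "a \<in> \<int>" by (intro corner [OF s *(1)]) blast+
    ultimately show ?thesis by (intro low) blast+
  next
    assume *: "r + p = s" "0 < q" "q < r" "q < p"
    then have "p + q < s" "q + r < s" "0 < r" "0 < p" by simp_all
    note Y(2) [OF *(2)] Z(1) [OF this(1)] X(1) [OF this(2)] Z(2) [OF this(3)] X(2) [OF this(4)]
    moreover from this have "b \<in> \<int>" by (intro corner [OF s2(1) *(1)]) blast+
    ultimately show ?thesis by (intro low) blast+
  next
    assume *: "p + q = s" "0 < r" "r < p" "r < q"
    then have "q + r < s" "r + p < s" "0 < p" "0 < q" by simp_all
    note Z(2) [OF *(2)] X(1) [OF this(1)] Y(1) [OF this(2)] X(2) [OF this(3)] Y(2) [OF this(4)]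
    moreover from this have "c \<in> \<int>" by (intro corner [OF s2(2) *(1)]) blast+
    ultimately show ?thesis by (intro low) blast+
  qed
qed

section \<open>Hexagons with natural parameters are net pentagons\<close>

lemma bounded_hexagon:
  assumes "0 \<le> a" "0 \<le> b" "0 \<le> c"
  shows "bounded (hexagon n A B C a b c p q r)"
proof (rule bounded_subset)
  show "bounded (convex hull {A, B, C})"
    by (simp add: bounded_convex_hull)
  show "hexagon n A B C a b c p q r \<subseteq> convex hull {A, B, C}"
  proof
    fix P assume "P \<in> hexagon n A B C a b c p q r"
    then have "0 \<le> x P" "0 \<le> y P" "0 \<le> z P" using assms by (auto simp: hexagon_def)
    moreover have "x P / n + y P / n + z P / n = 1"
      using sum_bary [of P] n_pos by (simp flip: add_divide_distrib)
    ultimately show "P \<in> convex hull {A, B, C}"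
      using bary_decompose [of P] unfolding convex_hull_3
      by (intro CollectI exI [of _ "x P / n"] exI [of _ "y P / n"] exI [of _ "z P / n"]) auto
  qed
qed

lemma aff_dim_hexagon:
  assumes s: "a + b + c + s = real n" and zero: "one_side_zero s p q r"
  shows "aff_dim (hexagon n A B C a b c p q r) = 2"
proof -
  \<comment> \<open>the mean of the six corners\<close>
  let ?\<alpha> = "a + (2 * s - 2 * p + q + r) / 6"
  let ?\<beta> = "b + (2 * s - 2 * q + r + p) / 6"
  let ?\<gamma> = "c + (2 * s - 2 * r + p + q) / 6"
  have "?\<alpha> + ?\<beta> + ?\<gamma> = real n" using s by (simp add: field_simps)
  then obtain P where P: "x P = ?\<alpha>" "y P = ?\<beta>" "z P = ?\<gamma>" by (rule point_with_bary)
  have "P \<in> interior (hexagon n A B C a b c p q r)"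
    by (rule interior_hexagon; unfold P; use s zero [unfolded one_side_zero_def] in argo)
  then have "interior (hexagon n A B C a b c p q r) \<noteq> {}" by blast
  then show ?thesis by (simp add: aff_dim_nonempty_interior)
qed

text \<open>Lines with \<open>i \<ge> n\<close> meet the triangle in at most the vertex
  \<open>A\<close>, too little for an edge.\<close>

lemma edge_on_line_in_net:
  assumes e: "aff_dim e = 1" "e \<subseteq> {P. x P = real i}" "\<forall>P\<in>e. 0 \<le> y P \<and> 0 \<le> z P"
  shows "\<exists>s \<in> triangular_net n A B C. e \<subseteq> s"
proof -
  interpret R: net n B C A by (rule rotate)
  have "e \<subseteq> level n A B C i" using e by (auto simp: level_def)
  moreover have "i < n"
  proof (rule ccontr)
    assume "\<not> i < n"
    then have "y P = 0 \<and> z P = 0" if "P \<in> e" for P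
      using e(2,3) that sum_bary [of P] by force
    then have eq: "P = Q" if "P \<in> e" "Q \<in> e" for P Q
      using that R.bary_inj [of P Q] by simp
    have "e \<noteq> {}" using e(1) by auto
    then obtain P where "P \<in> e" by blast
    then have "e = {P}" using eq by blast
    then show False using e(1) by simp
  qed
  ultimately show ?thesis unfolding triangular_net_eq by blast
qed

text \<open>A face that meets the relative interior of \<open>e\<close> contains \<open>e\<close>,
  so tightness at the one point \<open>m\<close> places all of \<open>e\<close> on a supporting
  line; \<open>b + c + p \<le> n\<close> makes the upper level a natural number.\<close>

lemma tight_edge_in_net:
  fixes a b c p :: nat and q r :: real
  assumes e: "e edge_of hexagon n A B C a b c p q r" and m: "m \<in> rel_interior e"
    and le: "b + c + p \<le> n" and tight: "x m = a \<or> x m = real n - b - c - p"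
  shows "\<exists>s \<in> triangular_net n A B C. e \<subseteq> s"
proof -
  let ?H = "hexagon n A B C a b c p q r"
  obtain i :: nat where i: "x m = i" "(\<forall>P\<in>?H. i \<le> x P) \<or> (\<forall>P\<in>?H. x P \<le> i)"
  proof (cases "x m = a")
    case True
    then show ?thesis by (rule that) (auto simp: hexagon_def)
  next
    case False
    then have "x m = real (n - (b + c + p))" using tight le by (simp add: of_nat_diff)
    then show ?thesis by (rule that) (use le in \<open>auto simp: hexagon_def of_nat_diff\<close>)
  qed
  have eH: "e \<subseteq> ?H" "aff_dim e = 1" using e by (auto simp: edge_of_def face_of_imp_subset)
  have "e \<subseteq> ?H \<inter> {P. x P = i}"
  proof (rule subset_of_face_of)
    show "(?H \<inter> {P. x P = i}) face_of ?H"
      using i(2) by (rule supporting_line_face [OF convex_hexagon])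
    show "?H \<inter> {P. x P = i} \<inter> rel_interior e \<noteq> {}"
      using m i(1) eH(1) rel_interior_subset by blast
  qed (rule eH)
  moreover have "\<forall>P\<in>e. 0 \<le> y P \<and> 0 \<le> z P"
    using eH(1) by (force simp: hexagon_def)
  ultimately show ?thesis using eH(2) by (intro edge_on_line_in_net) auto
qed

lemma hexagon_in_net_pentagons:
  fixes a b c p q r :: nat
  assumes le: "a + b + c \<le> n" and zero: "one_side_zero (n - (a + b + c)) p q r"
  shows "hexagon n A B C a b c p q r \<in> net_pentagons n A B C"
proof -
  interpret R: net n B C A by (rule rotate)
  interpret R2: net n C A B by (rule rotate2)
  let ?H = "hexagon n A B C a b c p q r"
  define s where "s = real (n - (a + b + c))"
  have s: "real a + real b + real c + s = real n" using le by (simp add: s_def of_nat_diff)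
  have zero': "one_side_zero s p q r" using zero by (simp add: s_def one_side_zero_of_nat)
  note nonneg = one_side_zero_imp_sides_nonneg [OF zero']
  have dim: "aff_dim ?H = 2" using aff_dim_hexagon [OF s zero'] .
  have "polytope ?H"
    by (simp add: polytope_eq_bounded_polyhedron polyhedron_hexagon bounded_hexagon)
  moreover have "card {v. v extreme_point_of ?H} = 5"
    using card_extreme_points_hexagon [OF s nonneg] zero' by simp
  moreover have "\<exists>s \<in> triangular_net n A B C. e \<subseteq> s" if e: "e edge_of ?H" for e
  proof -
    have rot: "hexagon n B C A b c a q r p = ?H" "hexagon n C A B c a b r p q = ?H"
      "triangular_net n B C A = triangular_net n A B C" "triangular_net n C A B = triangular_net n A B C"
      by (simp_all add: hexagon_rotate triangular_net_rotate)
    have bounds: "b + c + p \<le> n" "c + a + q \<le> n" "a + b + r \<le> n"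
      using zero le unfolding one_side_zero_def by linarith+
    have face: "e face_of ?H" "aff_dim e = 1" using e by (auto simp: edge_of_def)
    then have "convex e" "e \<noteq> {}" using convex_hexagon face_of_imp_convex by auto
    then obtain m where m: "m \<in> rel_interior e" using rel_interior_eq_empty by blast
    then have "m \<in> e" using rel_interior_subset by blast
    then have "m \<in> ?H" using face(1) face_of_imp_subset by blast
    have "e \<noteq> ?H" using face(2) dim by auto
    then have "m \<notin> rel_interior ?H"
      using face_of_disjoint_rel_interior face(1) \<open>m \<in> e\<close> by blast
    then have "m \<notin> interior ?H" using interior_subset_rel_interior by blast
    \<comment> \<open>A point of the hexagon satisfying all six bounds strictly would be
      interior.\<close>
    then consider "x m = a \<or> x m = real n - b - c - p" | "y m = b \<or> y m = real n - c - a - q"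
      | "z m = c \<or> z m = real n - a - b - r"
      using \<open>m \<in> ?H\<close> interior_hexagon [of a m b c p q r] unfolding hexagon_def mem_Collect_eq by linarith
    then show ?thesis
    proof cases
      case 1 then show ?thesis using tight_edge_in_net [OF e m bounds(1)] by blast
    next
      case 2 then show ?thesis
        using R.tight_edge_in_net [of e b c a q r p m, unfolded rot, OF e m bounds(2)] by blast
    next
      case 3 then show ?thesis
        using R2.tight_edge_in_net [of e c a b r p q m, unfolded rot, OF e m bounds(3)] by blast
    qed
  qed
  ultimately show ?thesis
    using dim by (simp add: net_pentagons_def convex_pentagon_def)
qed

section \<open>Bijection between parameters and net pentagons\<close>

lemma net_pentagon_hexagon:
  assumes "S \<in> net_pentagons n A B C"
  obtains a b c p q r :: nat where "a + b + c \<le> n" "one_side_zero (n - (a + b + c)) p q r"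
    "S = hexagon n A B C a b c p q r"
proof -
  have S: "polytope S" "aff_dim S = 2" "card {v. v extreme_point_of S} = 5"
    and edges: "\<forall>e. e edge_of S \<longrightarrow> (\<exists>s \<in> triangular_net n A B C. e \<subseteq> s)"
    using assms by (auto simp: net_pentagons_def convex_pentagon_def)
  obtain a b c s p q r where s: "a + b + c + s = real n" and nonneg: "sides_nonneg s p q r"
    and H: "S = hexagon n A B C a b c p q r"
    by (rule net_polygon_is_hexagon [OF S(1,2) edges])
  have zero: "one_side_zero s p q r"
    using card_extreme_points_hexagon [OF s nonneg] S(3) H by simp
  have "{a, b, c, p, q, r} \<subseteq> \<int> \<inter> {0..}"
    using net_pentagon_integral [OF s zero] edges H by blast
  then obtain a' b' c' p' q' r' :: nat where
    nat: "a = a'" "b = b'" "c = c'" "p = p'" "q = q'" "r = r'"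
    using real_nat_if_Ints_nonneg by (metis Int_iff atLeast_iff insert_subset)
  have "0 \<le> s" using nonneg by (auto simp: sides_nonneg_def)
  then have le: "a' + b' + c' \<le> n" using s by (simp add: nat)
  then have "s = real (n - (a' + b' + c'))" using s by (simp add: nat of_nat_diff)
  then have "one_side_zero (n - (a' + b' + c')) p' q' r'"
    using zero by (simp add: nat one_side_zero_of_nat)
  with le show ?thesis using that H nat by blast
qed

text \<open>Both bounds of \<open>x\<close> are attained on the hexagon, so they can be read off
  from the set.\<close>

lemma hexagon_determines_bounds:
  assumes "a + b + c + s = real n" "sides_nonneg s p q r"
    and "a' + b' + c' + s' = real n" "sides_nonneg s' p' q' r'"
    and eq: "hexagon n A B C a b c p q r = hexagon n A B C a' b' c' p' q' r'"
  shows "a = a'" "b + c + p = b' + c' + p'"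
proof -
  obtain U V U' V' where 1: "{U, V, U', V'} \<subseteq> hexagon n A B C a b c p q r"
    "x U = a" "x U' = real n - b - c - p"
    using hexagon_side_ends [OF assms(1,2)] by metis
  obtain W Z W' Z' where 2: "{W, Z, W', Z'} \<subseteq> hexagon n A B C a' b' c' p' q' r'"
    "x W = a'" "x W' = real n - b' - c' - p'"
    using hexagon_side_ends [OF assms(3,4)] by metis
  have "U \<in> hexagon n A B C a' b' c' p' q' r'" "U' \<in> hexagon n A B C a' b' c' p' q' r'"
    "W \<in> hexagon n A B C a b c p q r" "W' \<in> hexagon n A B C a b c p q r"
    using 1 2 eq by auto
  then show "a = a'" "b + c + p = b' + c' + p'"
    using 1 2 by (auto simp: hexagon_def)
qed

text \<open>The three rotations recover \<open>a\<close>, \<open>b\<close>, \<open>c\<close>, after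
  which the upper bounds give \<open>p\<close>, \<open>q\<close>, \<open>r\<close>.\<close>

lemma inj_on_hexagon:
  "inj_on (\<lambda>(a, b, c, p, q, r). hexagon n A B C (real a) (real b) (real c) (real p) (real q) (real r))
     (placements n)"
proof (rule inj_onI, simp only: split_paired_all prod.case)
  interpret R: net n B C A by (rule rotate)
  interpret R2: net n C A B by (rule rotate2)
  fix a b c p q r a' b' c' p' q' r'
  assume pl: "(a, b, c, p, q, r) \<in> placements n" "(a', b', c', p', q', r') \<in> placements n"
    and eq: "hexagon n A B C (real a) (real b) (real c) (real p) (real q) (real r) =
      hexagon n A B C (real a') (real b') (real c') (real p') (real q') (real r')"
  have *: "real a + real b + real c + real (n - (a + b + c)) = n"
      "sides_nonneg (real (n - (a + b + c))) p q r"
    if "(a, b, c, p, q, r) \<in> placements n" for a b c p q r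
  proof -
    show "real a + real b + real c + real (n - (a + b + c)) = n"
      using that by (simp add: placements_def of_nat_diff)
    have "one_side_zero (real (n - (a + b + c))) p q r"
      unfolding one_side_zero_of_nat using that by (simp add: placements_def)
    then show "sides_nonneg (real (n - (a + b + c))) p q r"
      by (rule one_side_zero_imp_sides_nonneg)
  qed
  note X = hexagon_determines_bounds [OF *[OF pl(1)] *[OF pl(2)] eq]
  have **: "real b + real c + real a + real (n - (a + b + c)) = n"
      "real c + real a + real b + real (n - (a + b + c)) = n"
      "sides_nonneg (real (n - (a + b + c))) q r p" "sides_nonneg (real (n - (a + b + c))) r p q"
    if "(a, b, c, p, q, r) \<in> placements n" for a b c p q r
    using *[OF that] by (auto simp: sides_nonneg_def)
  have rot: "hexagon n B C A b c a q r p = hexagon n A B C a b c p q r"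
    "hexagon n C A B c a b r p q = hexagon n A B C a b c p q r" for a b c p q r
    by (simp_all add: hexagon_rotate)
  note Y = R.hexagon_determines_bounds [OF **(1,3)[OF pl(1)] **(1,3)[OF pl(2)], unfolded rot, OF eq]
  note Z = R2.hexagon_determines_bounds [OF **(2,4)[OF pl(1)] **(2,4)[OF pl(2)], unfolded rot, OF eq]
  show "(a, b, c, p, q, r) = (a', b', c', p', q', r')"
    using X Y Z by simp
qed

lemma net_pentagons_eq:
  "net_pentagons n A B C =
    (\<lambda>(a, b, c, p, q, r). hexagon n A B C (real a) (real b) (real c) (real p) (real q) (real r)) ` placements n"
proof (intro equalityI subsetI)
  fix S assume "S \<in> net_pentagons n A B C"
  then obtain a b c p q r :: nat where "a + b + c \<le> n" "one_side_zero (n - (a + b + c)) p q r"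
    "S = hexagon n A B C a b c p q r"
    by (rule net_pentagon_hexagon)
  then show "S \<in> (\<lambda>(a, b, c, p, q, r).
      hexagon n A B C (real a) (real b) (real c) (real p) (real q) (real r)) ` placements n"
    by (intro image_eqI [of _ _ "(a, b, c, p, q, r)"]) (auto simp: placements_def)
qed (auto simp: placements_def hexagon_in_net_pentagons)

end

theorem theorem2p1:
  fixes n :: nat and A B C :: "real^2"
  assumes "n \<ge> 1"
    and "\<not> collinear {A, B, C}"
  shows "finite (net_pentagons n A B C) \<and>
    (\<forall>k::nat. n = 2 * k + 1 \<longrightarrow>
       real (card (net_pentagons n A B C)) =
         1 / 10 * (12 * real k ^ 5 + 25 * real k ^ 4 + 5 * real k ^ 3 - 10 * real k ^ 2 - 2 * real k)) \<and>
    (\<forall>k::nat. k \<ge> 1 \<and> n = 2 * k \<longrightarrow>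
       real (card (net_pentagons n A B C)) =
         1 / 10 * (12 * real k ^ 5 - 5 * real k ^ 4 - 15 * real k ^ 3 + 5 * real k ^ 2 + 3 * real k))"
proof -
  interpret net n A B C using assms by unfold_locales
  have card: "card (net_pentagons n A B C) = card (placements n)"
    unfolding net_pentagons_eq by (rule card_image [OF inj_on_hexagon])
  have "finite (net_pentagons n A B C)"
    unfolding net_pentagons_eq using card_placements_sum by blast
  then show ?thesis
    unfolding card using card_placements by auto
qed

end
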